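(* Let $G$ be a graph with at least one triangle, and let $H$ be the subgraph of $G$ obtained by deleting all edges that are not contained in a triangle. Suppose that $F$ is a graph without isolated vertices. Then $K_1\vee F$ is a subgraph of $G$ if one of the following holds: (1) $\gamma_3(G)>\frac{1}{2}\,\mathrm{spex}\left(\Delta(H),F\right)$. (2) $6|C_3(G)|>|V(G)|\,\rho_2(H)\,\mathrm{spex}\left(\Delta(H),F\right)$. (3) $\rho_3(G)>\frac{1}{2}\Delta(H)\,\mathrm{spex}\left(\Delta(H),F\right)$.
   Context: Graphs are finite and simple. $C_r(G)$ is the set of $r$-cliques of $G$ (sets of $r$ vertices inducing a complete graph), and $\Delta(H)$ is the maximum degree of a graph $H$. The $r$-clique tensor $\mathcal{A}_r(G)=(a_{i_1\cdots i_r})$ is the $r$-order $|V(G)|$-dimension tensor with $a_{i_1\cdots i_r}=\frac{1}{(r-1)!}$ if $\{i_1,\ldots,i_r\}\in C_r(G)$ and $0$ otherwise. For an $m$-order $n$-dimension tensor $\mathcal{A}=(a_{i_1\cdots i_m})$ and $x\in\mathbb{C}^n$, $\mathcal{A}x^{m-1}\in\mathbb{C}^n$ is the vector with $i$-th component $\sum_{i_2,\ldots,i_m=1}^n a_{ii_2\cdots i_m}x_{i_2}\cdots x_{i_m}$; $\lambda\in\mathbb{C}$ is an eigenvalue of $\mathcal{A}$ if $\mathcal{A}x^{m-1}=\lambda x^{[m-1]}$ for some nonzero $x\in\mathbb{C}^n$, where $x^{[m-1]}=(x_1^{m-1},\ldots,x_n^{m-1})^\top$; the spectral radius of $\mathcal{A}$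 is the largest modulus of its eigenvalues. The $r$-clique spectral radius $\rho_r(G)$ is the spectral radius of $\mathcal{A}_r(G)$ (so $\rho_2(G)$ is the spectral radius of the adjacency matrix of $G$). With $H$ as in the claim, $\gamma_3(G)=\rho_3(G)/\rho_2(H)$. For a graph $F$, $K_1\vee F$ is the graph with vertex set $V(F)\cup\{x\}$ (with $x\notin V(F)$ a new vertex) and edge set $E(F)\cup\{xu: u\in V(F)\}$. $\mathrm{spex}(n,F)$ is the maximum (adjacency) spectral radius of an $n$-vertex $F$-free graph, where $F$-free means having no subgraph (not necessarily induced) isomorphic to $F$. *)

theory Defs
  imports Complex_Main "Graph_Theory.Graph_Theory"
begin

text \<open>
  A finite simple graph is a \<^locale>\<open>pair_graph\<close>: an edge \<open>uv\<close> is the pair of arcs \<open>(u,v)\<close>, \<open>(v,u)\<close>,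
  so the degree of a vertex is its \<^const>\<open>out_degree\<close>.
\<close>

definition max_degree :: "'a pair_pre_digraph \<Rightarrow> nat" where
  "max_degree G = Max (out_degree (with_proj G) ` pverts G)"

text \<open>Some (not necessarily induced) subgraph of \<open>G\<close> is isomorphic to \<open>F\<close>.\<close>
definition contains_copy :: "'a pair_pre_digraph \<Rightarrow> 'b pair_pre_digraph \<Rightarrow> bool" where
  "contains_copy G F \<longleftrightarrow> (\<exists>S. subgraph S (with_proj G) \<and> digraph_iso (with_proj F) S)"

text \<open>The condition \<open>S \<subseteq> pverts G\<close> is needed since \<open>G \<restriction> S\<close> has vertex set \<open>S\<close> for any \<open>S\<close>.\<close>
definition cliques :: "nat \<Rightarrow> 'a pair_pre_digraph \<Rightarrow> 'a set set" where
  "cliques r G = {S. S \<subseteq> pverts G \<and> complete_digraph r (with_proj G \<restriction> S)}"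

text \<open>
  A tensor of order \<open>m\<close> whose indices range over the finite set \<open>I\<close> is a function on lists of
  indices; only its values on lists of length \<open>m\<close> over \<open>I\<close> matter.  Likewise a vector is a function,
  of which only the values on \<open>I\<close> matter.
\<close>
definition tensor_apply ::
  "nat \<Rightarrow> 'a set \<Rightarrow> ('a list \<Rightarrow> complex) \<Rightarrow> ('a \<Rightarrow> complex) \<Rightarrow> 'a \<Rightarrow> complex" where
  "tensor_apply m I A x i =
     (\<Sum>js | set js \<subseteq> I \<and> length js = m - 1. A (i # js) * (\<Prod>j\<leftarrow>js. x j))"

definition tensor_eigenvalue ::
  "nat \<Rightarrow> 'a set \<Rightarrow> ('a list \<Rightarrow> complex) \<Rightarrow> complex \<Rightarrow> bool" where
  "tensor_eigenvalue m I A l \<longleftrightarrow>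
     (\<exists>x. (\<exists>i\<in>I. x i \<noteq> 0) \<and> (\<forall>i\<in>I. tensor_apply m I A x i = l * x i ^ (m - 1)))"

text \<open>
  For \<open>m \<ge> 2\<close> and finite nonempty \<open>I\<close> the set of eigenvalues is compact and nonempty, so
  that the supremum is the largest modulus of an eigenvalue.
\<close>
definition tensor_spectral_radius :: "nat \<Rightarrow> 'a set \<Rightarrow> ('a list \<Rightarrow> complex) \<Rightarrow> real" where
  "tensor_spectral_radius m I A = Sup (cmod ` {l. tensor_eigenvalue m I A l})"

definition clique_tensor :: "nat \<Rightarrow> 'a pair_pre_digraph \<Rightarrow> 'a list \<Rightarrow> complex" where
  "clique_tensor r G is = (if set is \<in> cliques r G then 1 / fact (r - 1) else 0)"

text \<open>For \<open>r = 2\<close> the clique tensor is the adjacency matrix, and this is its spectral radius.\<close>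
definition clique_spectral_radius :: "nat \<Rightarrow> 'a pair_pre_digraph \<Rightarrow> real" where
  "clique_spectral_radius r G = tensor_spectral_radius r (pverts G) (clique_tensor r G)"

definition triangle_subgraph :: "'a pair_pre_digraph \<Rightarrow> 'a pair_pre_digraph" where
  "triangle_subgraph G =
     \<lparr> pverts = pverts G,
       parcs = {(u, v). (u, v) \<in> parcs G \<and> (\<exists>T\<in>cliques 3 G. u \<in> T \<and> v \<in> T)} \<rparr>"

definition gamma3 :: "'a pair_pre_digraph \<Rightarrow> real" where
  "gamma3 G = clique_spectral_radius 3 G / clique_spectral_radius 2 (triangle_subgraph G)"

text \<open>\<open>K\<^sub>1 \<or> F\<close>, with \<open>None\<close> as the new vertex.\<close>
definition cone :: "'b pair_pre_digraph \<Rightarrow> 'b option pair_pre_digraph" where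
  "cone F =
     \<lparr> pverts = insert None (Some ` pverts F),
       parcs = map_prod Some Some ` parcs F
               \<union> {None} \<times> Some ` pverts F \<union> Some ` pverts F \<times> {None} \<rparr>"

text \<open>
  Up to isomorphism every \<open>n\<close>-vertex graph has vertex set \<open>{..<n}\<close>, and there are only finitely many
  graphs on that set.
\<close>
definition spex :: "nat \<Rightarrow> 'b pair_pre_digraph \<Rightarrow> real" where
  "spex n F =
     Max {clique_spectral_radius 2 Q | Q :: nat pair_pre_digraph.
            pair_graph Q \<and> pverts Q = {..<n} \<and> \<not> contains_copy Q F}"

end

theory Submission
  imports "HOL-Analysis.Function_Topology" Defs
begin

text \<open>
  Write \<open>s\<close> for \<open>spex (\<Delta>(H)) F\<close>.  If \<open>K\<^sub>1 \<or> F\<close> is not contained in \<open>G\<close>, then the link in \<open>H\<close> of every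
  vertex \<open>v\<close> is \<open>F\<close>-free; padding it with isolated vertices to \<open>\<Delta>(H)\<close> vertices leaves it \<open>F\<close>-free, because
  \<open>F\<close> has no isolated vertices, so its adjacency form is at most \<open>s\<close> times the squared norm.  If
  \<open>x\<close> is an eigenvector of the 3-clique tensor for \<open>\<lambda>\<close>, this gives
  \<open>|\<lambda>| |x\<^sub>v|\<^sup>2 \<le> (s / 2) (\<Sum>u \<in> N\<^sub>H(v). |x\<^sub>u|\<^sup>2)\<close>.  Hence the vector \<open>y\<close> of the \<open>|x\<^sub>v|\<^sup>2\<close> satisfies
  \<open>|\<lambda>| y \<le> (s / 2) A\<^sub>H y\<close>, and pairing with \<open>y\<close> bounds \<open>|\<lambda>|\<close> by \<open>s \<rho>\<^sub>2(H) / 2\<close>, which contradicts (1), and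
  (3) as \<open>\<rho>\<^sub>2(H) \<le> \<Delta>(H)\<close>.  Applying the bound for the links to the all-one vector and summing over \<open>v\<close>
  contradicts (2).
\<close>

subsection \<open>The maximum of a Rayleigh quotient\<close>

text \<open>For small \<open>t\<close> the linear term outweighs the quadratic one and takes both
  signs. This serves as the first-order condition at a maximum, in place of derivatives.\<close>

lemma quadratic_nonpos_imp_linear_zero:
  fixes a b :: real
  assumes "\<And>t. a * t + b * t\<^sup>2 \<le> 0"
  shows "a = 0"
proof (rule ccontr)
  assume "a \<noteq> 0"
  \<comment> \<open>Since \<open>c\<close> is positive and \<open>c + b > 0\<close>, the point
    \<open>a / c\<close> makes the polynomial positive.\<close>
  define c where "c = \<bar>b\<bar> + 1"
  have c: "c > 0" "b > - c" by (auto simp: c_def)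
  have "a * (a / c) + b * (a / c)\<^sup>2 = a\<^sup>2 * (c + b) / c\<^sup>2"
    using c by (simp add: field_simps power2_eq_square)
  also have "\<dots> > 0"
    using c \<open>a \<noteq> 0\<close> by simp
  finally show False using assms[of "a / c"] by simp
qed

definition quadratic_form :: "'a set \<Rightarrow> ('a \<Rightarrow> 'a \<Rightarrow> real) \<Rightarrow> ('a \<Rightarrow> real) \<Rightarrow> real" where
  "quadratic_form V a y = (\<Sum>i\<in>V. \<Sum>j\<in>V. a i j * y i * y j)"

lemma quadratic_form_scale: "quadratic_form V a (\<lambda>i. c * y i) = c\<^sup>2 * quadratic_form V a y"
  unfolding quadratic_form_def by (simp add: sum_distrib_left power2_eq_square mult_ac)

lemma quadratic_form_cong: "(\<And>i. i \<in> V \<Longrightarrow> y i = z i) \<Longrightarrow> quadratic_form V a y = quadratic_form V a z"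
  unfolding quadratic_form_def by (intro sum.cong refl) auto

text \<open>Perturbing one coordinate at a time is enough for the first-order condition. Symmetry
  merges the two mixed terms into twice the \<open>k\<close>-th row.\<close>

lemma quadratic_form_add_unit:
  assumes "finite V" "k \<in> V" and sym: "\<And>i j. i \<in> V \<Longrightarrow> j \<in> V \<Longrightarrow> a i j = a j i"
  shows "quadratic_form V a (y(k := y k + t)) =
    quadratic_form V a y + 2 * t * (\<Sum>j\<in>V. a k j * y j) + t\<^sup>2 * a k k"
proof -
  define e where "e i = (if i = k then t else 0)" for i
  have y: "y(k := y k + t) = (\<lambda>i. y i + e i)" by (auto simp: e_def)
  have "quadratic_form V a (\<lambda>i. y i + e i) = quadratic_form V a y + (\<Sum>i\<in>V. \<Sum>j\<in>V. a i j * e i * y j)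
      + (\<Sum>i\<in>V. \<Sum>j\<in>V. a i j * y i * e j) + (\<Sum>i\<in>V. \<Sum>j\<in>V. a i j * e i * e j)"
    unfolding quadratic_form_def by (simp add: sum.distrib[symmetric] algebra_simps)
  also have "(\<Sum>i\<in>V. \<Sum>j\<in>V. a i j * y i * e j) = (\<Sum>i\<in>V. \<Sum>j\<in>V. a i j * e i * y j)"
    by (subst sum.swap) (intro sum.cong refl, simp add: sym mult_ac)
  also have "(\<Sum>i\<in>V. \<Sum>j\<in>V. a i j * e i * y j) =
      (\<Sum>i\<in>V. if i = k then t * (\<Sum>j\<in>V. a k j * y j) else 0)"
    by (intro sum.cong refl) (simp add: e_def sum_distrib_left mult_ac)
  also have "\<dots> = t * (\<Sum>j\<in>V. a k j * y j)" using assms by simp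
  also have "(\<Sum>i\<in>V. \<Sum>j\<in>V. a i j * e i * e j) =
      (\<Sum>i\<in>V. if i = k then \<Sum>j\<in>V. if j = k then t\<^sup>2 * a k k else 0 else 0)"
    by (intro sum.cong refl) (auto simp: e_def power2_eq_square intro!: sum.cong sum.neutral)
  also have "\<dots> = t\<^sup>2 * a k k" using assms by simp
  finally show ?thesis unfolding y by simp
qed

text \<open>The form attains a maximum \<open>l\<close> on the compact unit sphere, and homogeneity
  extends the bound to all vectors. At a maximiser the form minus \<open>l\<close> times the squared
  norm is zero, its largest value, so its first-order variation vanishes in each coordinate, which
  is the eigenvector equation.\<close>

lemma rayleigh_maximum:
  fixes a :: "'a \<Rightarrow> 'a \<Rightarrow> real"
  assumes fin: "finite V" and ne: "V \<noteq> {}"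
    and sym: "\<And>i j. i \<in> V \<Longrightarrow> j \<in> V \<Longrightarrow> a i j = a j i"
  obtains l x where "\<exists>i\<in>V. x i \<noteq> 0" "\<And>i. i \<in> V \<Longrightarrow> (\<Sum>j\<in>V. a i j * x j) = l * x i"
    "\<And>y. quadratic_form V a y \<le> l * (\<Sum>i\<in>V. (y i)\<^sup>2)"
proof -
  define N where "N y = (\<Sum>i\<in>V. (y i)\<^sup>2)" for y :: "'a \<Rightarrow> real"
  \<comment> \<open>Vectors are functions on the whole type; they have to vanish outside \<open>V\<close> for compactness.\<close>
  define B where "B = PiE UNIV (\<lambda>i. if i \<in> V then {-1..1::real} else {0})"
  define S where "S = B \<inter> {y. N y = 1}"
  have cont: "continuous_on UNIV (\<lambda>y. y i)" for i :: 'a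
    by (intro continuous_on_product_coordinates)
  have N_cont: "continuous_on UNIV N"
    unfolding N_def by (intro continuous_intros cont)
  have "compactin (product_topology (\<lambda>i::'a. euclidean) UNIV) B"
    unfolding B_def compactin_PiE by auto
  then have "compact B"
    by (simp add: euclidean_product_topology)
  moreover have "closed {y. N y = 1}"
    using N_cont by (intro closed_Collect_eq continuous_on_const) auto
  ultimately have "compact S" unfolding S_def by (rule compact_Int_closed)
  obtain v where "v \<in> V" using ne by auto
  have "(\<lambda>i. if i = v then 1 else 0) \<in> S"
  proof -
    have "N (\<lambda>i. if i = v then 1 else 0) = (\<Sum>i\<in>V. if i = v then 1 else 0)"
      unfolding N_def by (intro sum.cong) auto
    then show ?thesis using \<open>v \<in> V\<close> fin by (auto simp: S_def B_def)
  qed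
  then have "S \<noteq> {}" by auto
  moreover have "continuous_on S (quadratic_form V a)"
    unfolding quadratic_form_def
    by (rule continuous_on_subset[OF _ subset_UNIV]) (intro continuous_intros cont)
  ultimately obtain x where x: "x \<in> S" and max: "\<And>y. y \<in> S \<Longrightarrow> quadratic_form V a y \<le> quadratic_form V a x"
    using continuous_attains_sup[OF \<open>compact S\<close>] by blast
  define l where "l = quadratic_form V a x"
  have bound: "quadratic_form V a y \<le> l * N y" for y
  proof (cases "N y = 0")
    case True
    then have "\<And>i. i \<in> V \<Longrightarrow> y i = 0"
      unfolding N_def using fin by (simp add: sum_nonneg_eq_0_iff)
    then have "quadratic_form V a y = 0" unfolding quadratic_form_def by simp
    then show ?thesis using True by simp
  next
    case False
    have Npos: "N y > 0" using False sum_nonneg[of V "\<lambda>i. (y i)\<^sup>2"] unfolding N_def by auto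
    \<comment> \<open>Normalising \<open>y\<close> and cutting it off outside \<open>V\<close> gives
      a point \<open>z\<close> of \<open>S\<close>; the form sees only the values on
      \<open>V\<close>.\<close>
    define c where "c = 1 / sqrt (N y)"
    have c2: "c\<^sup>2 = 1 / N y" using Npos by (simp add: c_def power_divide)
    define z where "z i = (if i \<in> V then c * y i else 0)" for i
    have "N z = c\<^sup>2 * N y"
      unfolding N_def z_def by (simp add: sum_distrib_left power_mult_distrib)
    then have Nz: "N z = 1" using c2 Npos by simp
    have "\<bar>z i\<bar> \<le> 1" if "i \<in> V" for i
    proof -
      have "(z i)\<^sup>2 \<le> N z" unfolding N_def using that fin by (intro member_le_sum) auto
      then show ?thesis using Nz by (simp add: abs_square_le_1)
    qed
    then have "z i \<in> {-1..1}" if "i \<in> V" for i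
      using that by (fastforce simp: abs_le_iff)
    moreover have "z i = 0" if "i \<notin> V" for i using that by (simp add: z_def)
    ultimately have "z \<in> S" using Nz by (simp add: S_def B_def PiE_def Pi_def)
    then have "quadratic_form V a z \<le> l" unfolding l_def by (rule max)
    moreover have "quadratic_form V a z = c\<^sup>2 * quadratic_form V a y"
      unfolding quadratic_form_scale[symmetric] by (rule quadratic_form_cong) (simp add: z_def)
    ultimately show ?thesis using c2 Npos by (simp add: field_simps)
  qed
  have Nx: "N x = 1" using x by (simp add: S_def)
  have nz: "\<exists>i\<in>V. x i \<noteq> 0"
  proof (rule ccontr)
    assume "\<not> (\<exists>i\<in>V. x i \<noteq> 0)"
    then have "N x = 0" by (simp add: N_def)
    with Nx show False by simp
  qed
  have eig: "(\<Sum>j\<in>V. a k j * x j) = l * x k" if k: "k \<in> V" for k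
  proof -
    \<comment> \<open>The left side is the form minus \<open>l * N\<close> at \<open>x\<close> with
      \<open>t\<close> added to its \<open>k\<close>-th coordinate; the constant term drops out
      because \<open>N x = 1\<close>.\<close>
    have "2 * ((\<Sum>j\<in>V. a k j * x j) - l * x k) * t + (a k k - l) * t\<^sup>2 \<le> 0" for t
    proof -
      have "N (x(k := x k + t)) = (x k + t)\<^sup>2 + (\<Sum>i\<in>V - {k}. (x i)\<^sup>2)"
        unfolding N_def using fin k by (subst sum.remove[of _ k]) auto
      also have "\<dots> = N x + 2 * t * x k + t\<^sup>2"
        unfolding N_def using fin k by (subst (2) sum.remove[of _ k]) (auto simp: power2_sum)
      finally have "N (x(k := x k + t)) = 1 + 2 * t * x k + t\<^sup>2" using Nx by simp
      moreover have "quadratic_form V a (x(k := x k + t))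
          = l + 2 * t * (\<Sum>j\<in>V. a k j * x j) + t\<^sup>2 * a k k"
        using quadratic_form_add_unit[OF fin k sym] by (simp add: l_def)
      ultimately have "l + 2 * t * (\<Sum>j\<in>V. a k j * x j) + t\<^sup>2 * a k k \<le> l * (1 + 2 * t * x k + t\<^sup>2)"
        using bound[of "x(k := x k + t)"] by simp
      then show ?thesis by (simp add: algebra_simps)
    qed
    from quadratic_nonpos_imp_linear_zero[OF this] show ?thesis by simp
  qed
  show ?thesis using that[of x l] nz eig bound unfolding N_def by blast
qed

subsection \<open>Clique tensors of order 2 and 3\<close>

lemma in_cliques_iff:
  assumes "pair_graph G"
  shows "S \<in> cliques r G \<longleftrightarrow> S \<subseteq> pverts G \<and> finite S \<and> card S = r \<and>
    (\<forall>u\<in>S. \<forall>v\<in>S. u \<noteq> v \<longrightarrow> (u, v) \<in> parcs G)"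
proof -
  interpret pair_graph G by fact
  have eq: "with_proj G \<restriction> S = with_proj \<lparr>pverts = S, parcs = {e \<in> parcs G. fst e \<in> S \<and> snd e \<in> S}\<rparr>"
    by (simp add: induce_subgraph_def with_proj_def)
  \<comment> \<open>Only the inclusion from right to left carries information; absence of loops
    gives the other one.\<close>
  have "{e \<in> parcs G. fst e \<in> S \<and> snd e \<in> S} = {(u, v). (u, v) \<in> S \<times> S \<and> u \<noteq> v} \<longleftrightarrow>
      (\<forall>u\<in>S. \<forall>v\<in>S. u \<noteq> v \<longrightarrow> (u, v) \<in> parcs G)"
    using no_loops' by (fastforce simp: set_eq_iff)
  then show ?thesis
    unfolding cliques_def eq mem_Collect_eq complete_digraph_pair_def by auto
qed

lemma pair_in_cliques_iff:
  assumes "pair_graph G"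
  shows "{u, v} \<in> cliques 2 G \<longleftrightarrow> (u, v) \<in> parcs G"
proof -
  interpret pair_graph G by fact
  show ?thesis
    unfolding in_cliques_iff[OF assms]
    using no_loops'[of u v] arcs_symmetric[of u v] in_arcsD1[of u v] in_arcsD2[of u v]
    by (auto simp: card_insert_if)
qed

text \<open>If two of the vertices coincide, both sides fail: the set has fewer than three elements,
  and one of the arcs would be a loop.\<close>

lemma triple_in_cliques_iff:
  assumes "pair_graph G"
  shows "{u, v, w} \<in> cliques 3 G \<longleftrightarrow> (u, v) \<in> parcs G \<and> (u, w) \<in> parcs G \<and> (v, w) \<in> parcs G"
proof -
  interpret pair_graph G by fact
  have card: "card {u, v, w} = 3 \<longleftrightarrow> u \<noteq> v \<and> u \<noteq> w \<and> v \<noteq> w"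
    by (auto simp: card_insert_if)
  show ?thesis
    unfolding in_cliques_iff[OF assms] card
    using no_loops'[of u v] no_loops'[of u w] no_loops'[of v w]
      arcs_symmetric[of u v] arcs_symmetric[of u w] arcs_symmetric[of v w]
      in_arcsD1[of u v] in_arcsD2[of u v] in_arcsD2[of u w]
    by auto
qed

lemma out_degree_with_proj: "out_degree (with_proj G) v = card (parcs G `` {v})"
proof -
  have "out_arcs (with_proj G) v = Pair v ` (parcs G `` {v})"
    by (auto simp: out_arcs_def)
  then show ?thesis
    unfolding out_degree_def by (simp add: card_image inj_on_def)
qed

lemma out_degree_le_max_degree:
  assumes "finite (pverts G)" "v \<in> pverts G"
  shows "card (parcs G `` {v}) \<le> max_degree G"
  unfolding max_degree_def out_degree_with_proj using assms by (intro Max_ge) auto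

lemma tensor_apply_clique_2:
  assumes "pair_graph G"
  shows "tensor_apply 2 (pverts G) (clique_tensor 2 G) x i = (\<Sum>j\<in>parcs G `` {i}. x j)"
proof -
  interpret pair_graph G by fact
  have lists: "{js. set js \<subseteq> pverts G \<and> length js = 2 - 1} = (\<lambda>j. [j]) ` pverts G"
    by (auto simp: length_Suc_conv)
  have "tensor_apply 2 (pverts G) (clique_tensor 2 G) x i =
      (\<Sum>j\<in>pverts G. if (i, j) \<in> parcs G then x j else 0)"
    unfolding tensor_apply_def lists
    by (subst sum.reindex)
      (auto simp: inj_on_def clique_tensor_def pair_in_cliques_iff[OF assms] intro!: sum.cong)
  also have "\<dots> = (\<Sum>j\<in>pverts G \<inter> parcs G `` {i}. x j)"
    by (simp add: sum.If_cases[OF pair_finite_verts] Image_singleton)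
  also have "pverts G \<inter> parcs G `` {i} = parcs G `` {i}" using in_arcsD2 by auto
  finally show ?thesis .
qed

text \<open>In a simple graph this is the subgraph induced on the neighbourhood of \<open>v\<close>;
  its arcs are the ordered pairs that complete \<open>v\<close> to a triangle.\<close>

definition link :: "'a pair_pre_digraph \<Rightarrow> 'a \<Rightarrow> 'a pair_pre_digraph" where
  "link G v =
     \<lparr>pverts = parcs G `` {v},
      parcs = {(j, k) \<in> parcs G. (v, j) \<in> parcs G \<and> (v, k) \<in> parcs G}\<rparr>"

lemma link_simps [simp]:
  "pverts (link G v) = parcs G `` {v}"
  "(j, k) \<in> parcs (link G v) \<longleftrightarrow> (j, k) \<in> parcs G \<and> (v, j) \<in> parcs G \<and> (v, k) \<in> parcs G"
  by (auto simp: link_def)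

text \<open>The nonzero entries of slice \<open>i\<close> sit exactly at the arcs of the link of
  \<open>i\<close>. The factor 1/2 is \<open>1 / fact (3 - 1)\<close>, so each edge of the link
  counts once.\<close>

lemma tensor_apply_clique_3:
  assumes "pair_graph G"
  shows "tensor_apply 3 (pverts G) (clique_tensor 3 G) x i = (\<Sum>(j, k)\<in>parcs (link G i). x j * x k) / 2"
proof -
  interpret pair_graph G by fact
  have clique: "set [i, j, k] \<in> cliques 3 G \<longleftrightarrow> (j, k) \<in> parcs (link G i)" for j k
    by (auto simp: triple_in_cliques_iff[OF assms])
  have lists: "{js. set js \<subseteq> pverts G \<and> length js = 3 - 1} =
      (\<lambda>(j, k). [j, k]) ` (pverts G \<times> pverts G)"
    by (auto simp: length_Suc_conv numeral_3_eq_3)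
  have "tensor_apply 3 (pverts G) (clique_tensor 3 G) x i =
      (\<Sum>p\<in>pverts G \<times> pverts G. if p \<in> parcs (link G i) then (case p of (j, k) \<Rightarrow> x j * x k / 2) else 0)"
    unfolding tensor_apply_def lists
    by (subst sum.reindex)
      (auto simp: inj_on_def clique_tensor_def clique fact_numeral simp del: list.set intro!: sum.cong)
  also have "\<dots> = (\<Sum>p\<in>pverts G \<times> pverts G \<inter> parcs (link G i). case p of (j, k) \<Rightarrow> x j * x k / 2)"
    by (simp add: sum.If_cases pair_finite_verts)
  also have "pverts G \<times> pverts G \<inter> parcs (link G i) = parcs (link G i)"
    using in_arcsD1 in_arcsD2 by auto
  finally show ?thesis by (simp add: sum_divide_distrib case_prod_unfold)
qed

text \<open>The quadratic form of the adjacency matrix: each edge is a pair of arcs and so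
  contributes twice.\<close>

definition adjacency_form :: "'a pair_pre_digraph \<Rightarrow> ('a \<Rightarrow> real) \<Rightarrow> real" where
  "adjacency_form G y = (\<Sum>(i, j)\<in>parcs G. y i * y j)"

lemma adjacency_form_nbrs:
  assumes "pair_graph G"
  shows "adjacency_form G y = (\<Sum>i\<in>pverts G. y i * (\<Sum>j\<in>parcs G `` {i}. y j))"
proof -
  interpret pair_graph G by fact
  have "parcs G = Sigma (pverts G) (\<lambda>i. parcs G `` {i})"
    using in_arcsD1 by auto
  moreover have "finite (parcs G `` {i})" for i
    using pair_finite_verts in_arcsD2 by (auto intro: rev_finite_subset)
  ultimately have "adjacency_form G y = (\<Sum>i\<in>pverts G. \<Sum>j\<in>parcs G `` {i}. y i * y j)"
    unfolding adjacency_form_def using sum.Sigma[of "pverts G" "\<lambda>i. parcs G `` {i}" "\<lambda>i j. y i * y j"]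
    by (simp add: pair_finite_verts)
  then show ?thesis by (simp add: sum_distrib_left)
qed

text \<open>Compare moduli in the eigenvalue equation at a vertex where the eigenvector has largest
  modulus. Besides bounding the radius, this makes the supremum in its definition one of a bounded
  set.\<close>

lemma eigenvalue_le_max_degree:
  assumes "pair_graph G" and l: "tensor_eigenvalue 2 (pverts G) (clique_tensor 2 G) l"
  shows "cmod l \<le> max_degree G"
proof -
  interpret pair_graph G by fact
  obtain x where nz: "\<exists>i\<in>pverts G. x i \<noteq> 0"
    and eig: "\<And>i. i \<in> pverts G \<Longrightarrow> (\<Sum>j\<in>parcs G `` {i}. x j) = l * x i"
    using l unfolding tensor_eigenvalue_def tensor_apply_clique_2[OF assms(1)] by auto
  have fin: "finite ((\<lambda>j. cmod (x j)) ` pverts G)" using pair_finite_verts by simp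
  moreover have "(\<lambda>j. cmod (x j)) ` pverts G \<noteq> {}" using nz by auto
  ultimately have "Max ((\<lambda>j. cmod (x j)) ` pverts G) \<in> (\<lambda>j. cmod (x j)) ` pverts G"
    by (rule Max_in)
  then obtain k where k: "k \<in> pverts G" and k_Max: "cmod (x k) = Max ((\<lambda>j. cmod (x j)) ` pverts G)"
    by auto
  have max: "cmod (x j) \<le> cmod (x k)" if "j \<in> pverts G" for j
    unfolding k_Max using fin that by (intro Max_ge) auto
  have pos: "cmod (x k) > 0"
  proof -
    obtain i where "i \<in> pverts G" "x i \<noteq> 0" using nz by auto
    then show ?thesis using max[of i] zero_less_norm_iff[of "x i"] by linarith
  qed
  have "cmod l * cmod (x k) = cmod (\<Sum>j\<in>parcs G `` {k}. x j)"
    unfolding eig[OF k] by (simp add: norm_mult)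
  also have "\<dots> \<le> (\<Sum>j\<in>parcs G `` {k}. cmod (x k))"
    using max in_arcsD2 by (intro sum_norm_le) auto
  also have "\<dots> = card (parcs G `` {k}) * cmod (x k)" by simp
  also have "\<dots> \<le> max_degree G * cmod (x k)"
    using out_degree_le_max_degree[OF pair_finite_verts k] by (intro mult_right_mono) auto
  finally show ?thesis using pos by simp
qed

text \<open>The Rayleigh maximum of the 0/1 adjacency matrix has a real eigenvector, which is also a
  complex eigenvector of the tensor of order 2.\<close>

lemma adjacency_form_eigenvalue:
  assumes "pair_graph G" and ne: "pverts G \<noteq> {}"
  obtains l where "tensor_eigenvalue 2 (pverts G) (clique_tensor 2 G) (complex_of_real l)"
    "\<And>y. adjacency_form G y \<le> l * (\<Sum>i\<in>pverts G. (y i)\<^sup>2)"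
proof -
  interpret pair_graph G by fact
  define a :: "'a \<Rightarrow> 'a \<Rightarrow> real" where "a i j = (if (i, j) \<in> parcs G then 1 else 0)" for i j
  have row: "(\<Sum>j\<in>pverts G. a i j * y j) = (\<Sum>j\<in>parcs G `` {i}. y j)" for i y
  proof -
    have "(\<Sum>j\<in>pverts G. a i j * y j) = (\<Sum>j\<in>pverts G. if (i, j) \<in> parcs G then y j else 0)"
      by (intro sum.cong) (auto simp: a_def)
    also have "\<dots> = (\<Sum>j\<in>pverts G \<inter> parcs G `` {i}. y j)"
      by (simp add: sum.If_cases[OF pair_finite_verts] Image_singleton)
    also have "pverts G \<inter> parcs G `` {i} = parcs G `` {i}" using in_arcsD2 by auto
    finally show ?thesis .
  qed
  have form: "quadratic_form (pverts G) a y = adjacency_form G y" for y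
    unfolding adjacency_form_nbrs[OF assms(1)] row[symmetric] quadratic_form_def
    by (simp add: sum_distrib_left mult_ac)
  have sym: "a i j = a j i" for i j
    using arcs_symmetric[of i j] arcs_symmetric[of j i] by (auto simp: a_def)
  obtain l x where nz: "\<exists>i\<in>pverts G. x i \<noteq> 0"
    and eig: "\<And>i. i \<in> pverts G \<Longrightarrow> (\<Sum>j\<in>pverts G. a i j * x j) = l * x i"
    and bound: "\<And>y. quadratic_form (pverts G) a y \<le> l * (\<Sum>i\<in>pverts G. (y i)\<^sup>2)"
    by (rule rayleigh_maximum[where a = a, OF pair_finite_verts ne sym]) blast
  have "tensor_eigenvalue 2 (pverts G) (clique_tensor 2 G) (complex_of_real l)"
    unfolding tensor_eigenvalue_def tensor_apply_clique_2[OF assms(1)]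
  proof (intro exI conjI ballI)
    show "\<exists>i\<in>pverts G. complex_of_real (x i) \<noteq> 0" using nz by auto
    show "(\<Sum>j\<in>parcs G `` {i}. complex_of_real (x j)) = complex_of_real l * complex_of_real (x i) ^ (2 - 1)"
      if "i \<in> pverts G" for i
      using eig[OF that] unfolding row by (simp flip: of_real_sum of_real_mult)
  qed
  then show ?thesis using that bound unfolding form by blast
qed

lemma spectral_radius_le_max_degree:
  assumes "pair_graph G" "pverts G \<noteq> {}"
  shows "clique_spectral_radius 2 G \<le> max_degree G"
proof -
  obtain l where "tensor_eigenvalue 2 (pverts G) (clique_tensor 2 G) (complex_of_real l)"
    using adjacency_form_eigenvalue[OF assms] by blast
  then have "cmod ` {l. tensor_eigenvalue 2 (pverts G) (clique_tensor 2 G) l} \<noteq> {}" by blast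
  then show ?thesis
    unfolding clique_spectral_radius_def tensor_spectral_radius_def
    by (rule cSup_least) (auto intro: eigenvalue_le_max_degree[OF assms(1)])
qed

lemma adjacency_form_le_spectral_radius:
  assumes "pair_graph G"
  shows "adjacency_form G y \<le> clique_spectral_radius 2 G * (\<Sum>i\<in>pverts G. (y i)\<^sup>2)"
\<comment> \<open>Without vertices there is no eigenvalue and the supremum is unspecified, but both
  sides of the claim are zero.\<close>
proof (cases "pverts G = {}")
  case True
  then show ?thesis by (simp add: adjacency_form_nbrs[OF assms])
next
  case False
  obtain l where l: "tensor_eigenvalue 2 (pverts G) (clique_tensor 2 G) (complex_of_real l)"
    and bound: "\<And>y. adjacency_form G y \<le> l * (\<Sum>i\<in>pverts G. (y i)\<^sup>2)"
    using adjacency_form_eigenvalue[OF assms False] by blast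
  have "l \<le> cmod (complex_of_real l)" by simp
  also have "\<dots> \<le> clique_spectral_radius 2 G"
    unfolding clique_spectral_radius_def tensor_spectral_radius_def
    using l eigenvalue_le_max_degree[OF assms] by (intro cSup_upper bdd_aboveI2) blast+
  finally show ?thesis
    using bound[of y] by (meson mult_right_mono order_trans sum_nonneg zero_le_power2)
qed

lemma spectral_radius_nonneg:
  assumes "pair_graph G" "pverts G \<noteq> {}"
  shows "0 \<le> clique_spectral_radius 2 G"
proof -
  interpret pair_graph G by fact
  obtain v where v: "v \<in> pverts G" using assms by auto
  \<comment> \<open>The unit vector at \<open>v\<close> has squared norm 1 and nonnegative entries,
    so the bound on its form is a lower bound for the radius.\<close>
  define y :: "'a \<Rightarrow> real" where "y i = (if i = v then 1 else 0)" for i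
  have "adjacency_form G y \<ge> 0"
    unfolding adjacency_form_def y_def by (intro sum_nonneg) auto
  moreover have "(\<Sum>i\<in>pverts G. (y i)\<^sup>2) = (\<Sum>i\<in>pverts G. if i = v then 1 else 0)"
    unfolding y_def by (intro sum.cong) auto
  ultimately show ?thesis
    using adjacency_form_le_spectral_radius[OF assms(1), of y] v by simp
qed

subsection \<open>Copies and spectral extremal numbers\<close>

text \<open>With \<open>contains_copyE\<close> this reduces copies to injective arc-preserving
  vertex maps. Arcs are pairs of vertices, so the arc part of the isomorphism has to be
  \<open>map_prod g g\<close>.\<close>

lemma contains_copyI:
  assumes "pair_wf_digraph G" "pair_wf_digraph F"
    and "inj_on g (pverts F)" "g ` pverts F \<subseteq> pverts G"
    and arcs: "\<And>u v. (u, v) \<in> parcs F \<Longrightarrow> (g u, g v) \<in> parcs G"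
  shows "contains_copy G F"
proof -
  interpret F: pair_wf_digraph F by fact
  define h where "h = \<lparr>iso_verts = g, iso_arcs = map_prod g g, iso_head = snd, iso_tail = fst\<rparr>"
  have "parcs F \<subseteq> pverts F \<times> pverts F" using F.in_arcsD1 F.in_arcsD2 by auto
  then have "inj_on (map_prod g g) (parcs F)"
    using map_prod_inj_on[OF assms(3) assms(3)] inj_on_subset by blast
  then have iso: "pre_digraph.digraph_isomorphism (with_proj F) h"
    using assms(2,3) by (auto simp: pre_digraph.digraph_isomorphism_def h_def wf_digraph_wp_iff)
  have "app_iso h (with_proj F) = with_proj \<lparr>pverts = g ` pverts F, parcs = map_prod g g ` parcs F\<rparr>"
    by (simp add: app_iso_def h_def with_proj_def)
  moreover have "pair_wf_digraph \<lparr>pverts = g ` pverts F, parcs = map_prod g g ` parcs F\<rparr>"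
    using F.in_arcsD1 F.in_arcsD2 by unfold_locales auto
  ultimately have "subgraph (app_iso h (with_proj F)) (with_proj G)"
    using assms by (auto simp: subgraph_def compatible_def wf_digraph_wp_iff)
  with iso show ?thesis unfolding contains_copy_def digraph_iso_def by blast
qed

lemma contains_copyE:
  assumes "contains_copy G F"
  obtains g where "inj_on g (pverts F)" "g ` pverts F \<subseteq> pverts G"
    "\<And>u v. (u, v) \<in> parcs F \<Longrightarrow> (g u, g v) \<in> parcs G"
proof -
  obtain h where sub: "subgraph (app_iso h (with_proj F)) (with_proj G)"
    and iso: "pre_digraph.digraph_isomorphism (with_proj F) h"
    using assms unfolding contains_copy_def digraph_iso_def by blast
  \<comment> \<open>A subgraph shares the tail and head maps of the ambient digraph, which here are
    the projections.\<close>
  have ends: "iso_tail h = fst" "iso_head h = snd"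
    using sub by (auto simp: subgraph_def compatible_def app_iso_def)
  show ?thesis
  proof (rule that[of "iso_verts h"])
    show "inj_on (iso_verts h) (pverts F)"
      using iso by (simp add: pre_digraph.digraph_isomorphism_def)
    show "iso_verts h ` pverts F \<subseteq> pverts G"
      using sub by (simp add: subgraph_def verts_app_iso)
    fix u v assume uv: "(u, v) \<in> parcs F"
    then have "iso_arcs h (u, v) = (iso_verts h u, iso_verts h v)"
      using iso unfolding pre_digraph.digraph_isomorphism_def ends
      by (metis fst_conv snd_conv prod.collapse with_proj_simps(2,4,5))
    moreover have "iso_arcs h (u, v) \<in> parcs G"
      using sub uv by (auto simp: subgraph_def arcs_app_iso)
    ultimately show "(iso_verts h u, iso_verts h v) \<in> parcs G" by simp
  qed
qed

text \<open>A graph on \<open>{..<n}\<close> is determined by its arc set. Finiteness is what lets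
  \<open>Max\<close> in \<open>spex\<close> bound each candidate.\<close>

lemma finite_spex_candidates:
  "finite {clique_spectral_radius 2 Q | Q :: nat pair_pre_digraph.
     pair_graph Q \<and> pverts Q = {..<n} \<and> \<not> contains_copy Q F}" (is "finite ?S")
proof -
  have "?S \<subseteq> (\<lambda>E. clique_spectral_radius 2 \<lparr>pverts = {..<n}, parcs = E\<rparr>) ` Pow ({..<n} \<times> {..<n})"
  proof
    fix r assume "r \<in> ?S"
    then obtain Q :: "nat pair_pre_digraph"
      where Q: "pair_graph Q" "pverts Q = {..<n}" "r = clique_spectral_radius 2 Q"
      by auto
    interpret pair_graph Q by fact
    have "parcs Q \<subseteq> {..<n} \<times> {..<n}" using in_arcsD1 in_arcsD2 Q by auto
    moreover have "Q = \<lparr>pverts = {..<n}, parcs = parcs Q\<rparr>" using Q by simp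
    ultimately show "r \<in> (\<lambda>E. clique_spectral_radius 2 \<lparr>pverts = {..<n}, parcs = E\<rparr>) ` Pow ({..<n} \<times> {..<n})"
      using Q(3) by (intro image_eqI[of _ _ "parcs Q"]) auto
  qed
  then show ?thesis by (rule finite_subset) simp
qed

lemma spectral_radius_le_spex:
  assumes "pair_graph Q" "pverts Q = {..<n}" "\<not> contains_copy Q F"
  shows "clique_spectral_radius 2 Q \<le> spex n F"
  unfolding spex_def using finite_spex_candidates assms by (intro Max_ge) auto

lemma spex_nonneg:
  assumes "n > 0" "parcs F \<noteq> {}"
  shows "0 \<le> spex n F"
proof -
  \<comment> \<open>The arcless graph is a candidate because \<open>F\<close> has an arc, and
    \<open>n > 0\<close> gives it a vertex.\<close>
  define Q where "Q = \<lparr>pverts = {..<n}, parcs = {}\<rparr>"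
  have Q: "pair_graph Q"
    by unfold_locales (auto simp: Q_def symmetric_def sym_def)
  have "\<not> contains_copy Q F"
    using assms(2) by (auto elim!: contains_copyE simp: Q_def)
  with Q have "clique_spectral_radius 2 Q \<le> spex n F"
    by (intro spectral_radius_le_spex) (auto simp: Q_def)
  moreover have "0 \<le> clique_spectral_radius 2 Q"
    using assms(1) by (intro spectral_radius_nonneg Q) (auto simp: Q_def)
  ultimately show ?thesis by simp
qed

text \<open>Links may have fewer than \<open>n\<close> vertices, so \<open>L\<close> is moved into
  \<open>{..<n}\<close> and the remaining numbers become isolated vertices.\<close>

lemma adjacency_form_le_spex:
  fixes L :: "'a pair_pre_digraph"
  assumes "pair_graph L" "card (pverts L) \<le> n" "pair_graph F"
    and no_isolated: "\<forall>v\<in>pverts F. parcs F `` {v} \<noteq> {}"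
    and free: "\<not> contains_copy L F"
  shows "adjacency_form L y \<le> spex n F * (\<Sum>v\<in>pverts L. (y v)\<^sup>2)"
proof -
  interpret L: pair_graph L by fact
  interpret F: pair_graph F by fact
  have "\<exists>f. inj_on f (pverts L) \<and> f ` pverts L \<subseteq> {..<n}"
    using assms(2) L.pair_finite_verts by (metis card_le_inj card_lessThan finite_lessThan)
  then obtain f where f: "inj_on f (pverts L)" "f ` pverts L \<subseteq> {..<n}" by blast
  have fn: "f v < n" if "v \<in> pverts L" for v using f(2) that by auto
  define Q where "Q = \<lparr>pverts = {..<n}, parcs = map_prod f f ` parcs L\<rparr>"
  have Q: "pair_graph Q"
  proof unfold_locales
    show "symmetric (with_proj Q)"
    proof -
      have "(b, a) \<in> parcs Q" if "(a, b) \<in> parcs Q" for a b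
      proof -
        obtain u v where "(u, v) \<in> parcs L" "a = f u" "b = f v"
          using \<open>(a, b) \<in> parcs Q\<close> by (auto simp: Q_def)
        with L.arcs_symmetric show ?thesis by (force simp: Q_def)
      qed
      then show ?thesis by (simp add: symmetric_def sym_def)
    qed
    show "fst e \<noteq> snd e" if e: "e \<in> parcs Q" for e
    proof -
      obtain u v where uv: "(u, v) \<in> parcs L" "e = (f u, f v)" using e by (auto simp: Q_def)
      then show ?thesis
        using L.no_loops'[OF uv(1)] L.in_arcsD1[OF uv(1)] L.in_arcsD2[OF uv(1)] f(1)
        by (simp add: inj_on_eq_iff)
    qed
  qed (use fn L.pair_finite_arcs in \<open>auto simp: Q_def dest: L.in_arcsD1 L.in_arcsD2\<close>)
  define f' where "f' = the_inv_into (pverts L) f"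
  have f': "f' (f v) = v" if "v \<in> pverts L" for v
    unfolding f'_def using f(1) that by (rule the_inv_into_f_f)
  have "\<not> contains_copy Q F"
  proof
    assume "contains_copy Q F"
    then obtain g where g: "inj_on g (pverts F)" "\<And>u v. (u, v) \<in> parcs F \<Longrightarrow> (g u, g v) \<in> parcs Q"
      by (rule contains_copyE) blast
    \<comment> \<open>Each vertex of \<open>F\<close> lies on an arc, and arcs of \<open>Q\<close>
      join images of vertices of \<open>L\<close>; hence the copy avoids the padding and can be
      pulled back by \<open>f'\<close>.\<close>
    have gf: "g u \<in> f ` pverts L" if "u \<in> pverts F" for u
    proof -
      have "parcs F `` {u} \<noteq> {}" using no_isolated that by simp
      then obtain w where "(u, w) \<in> parcs F" by auto
      from g(2)[OF this] show ?thesis by (auto simp: Q_def dest: L.in_arcsD1)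
    qed
    have "contains_copy L F"
    proof (rule contains_copyI[of _ _ "f' \<circ> g"])
      show "inj_on (f' \<circ> g) (pverts F)"
      proof (rule comp_inj_on[OF g(1)])
        show "inj_on f' (g ` pverts F)"
          unfolding f'_def using inj_on_the_inv_into[OF f(1)] by (rule inj_on_subset) (use gf in blast)
      qed
      show "(f' \<circ> g) ` pverts F \<subseteq> pverts L"
      proof
        fix w assume "w \<in> (f' \<circ> g) ` pverts F"
        then obtain u where "u \<in> pverts F" "w = f' (g u)" by auto
        with gf[of u] f' show "w \<in> pverts L" by auto
      qed
      show "((f' \<circ> g) u, (f' \<circ> g) v) \<in> parcs L" if uv: "(u, v) \<in> parcs F" for u v
      proof -
        obtain x y where "(x, y) \<in> parcs L" "g u = f x" "g v = f y"
          using g(2)[OF uv] by (auto simp: Q_def)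
        then show ?thesis by (simp add: f' L.in_arcsD1 L.in_arcsD2)
      qed
    qed (rule L.pair_wf_digraph F.pair_wf_digraph)+
    with free show False ..
  qed
  with Q have le: "clique_spectral_radius 2 Q \<le> spex n F"
    by (intro spectral_radius_le_spex) (auto simp: Q_def)
  \<comment> \<open>Extending by zero on the padding preserves both the form and the squared
    norm.\<close>
  define z where "z i = (if i \<in> f ` pverts L then y (f' i) else 0)" for i
  have zf: "z (f v) = y v" if "v \<in> pverts L" for v
    using that f' by (simp add: z_def)
  have "parcs L \<subseteq> pverts L \<times> pverts L" using L.in_arcsD1 L.in_arcsD2 by auto
  then have inj: "inj_on (map_prod f f) (parcs L)"
    using map_prod_inj_on[OF f(1) f(1)] inj_on_subset by blast
  have "adjacency_form Q z = adjacency_form L y"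
    unfolding adjacency_form_def Q_def
    by (simp add: sum.reindex[OF inj]) (intro sum.cong, auto simp: zf L.in_arcsD1 L.in_arcsD2)
  moreover have "(\<Sum>i\<in>pverts Q. (z i)\<^sup>2) = (\<Sum>i\<in>f ` pverts L. (z i)\<^sup>2)"
    using f(2) by (intro sum.mono_neutral_right) (auto simp: Q_def z_def)
  moreover have "\<dots> = (\<Sum>v\<in>pverts L. (y v)\<^sup>2)"
    by (simp add: sum.reindex[OF f(1)] zf)
  ultimately have "adjacency_form L y \<le> clique_spectral_radius 2 Q * (\<Sum>v\<in>pverts L. (y v)\<^sup>2)"
    using adjacency_form_le_spectral_radius[OF Q, of z] by simp
  also have "\<dots> \<le> spex n F * (\<Sum>v\<in>pverts L. (y v)\<^sup>2)"
    using le by (intro mult_right_mono sum_nonneg) auto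
  finally show ?thesis .
qed

section \<open>Links and cones\<close>

lemma pair_graph_link:
  assumes "pair_graph G"
  shows "pair_graph (link G v)"
proof -
  interpret pair_graph G by fact
  have "finite (parcs G `` {v})"
    using pair_finite_verts by (rule rev_finite_subset) (auto dest: in_arcsD2)
  moreover have "finite (parcs (link G v))"
    using pair_finite_arcs by (rule rev_finite_subset) auto
  ultimately show ?thesis
    by unfold_locales (auto simp: symmetric_def sym_def intro: arcs_symmetric dest: no_loops')
qed

lemma pair_wf_digraph_cone:
  assumes "pair_wf_digraph F"
  shows "pair_wf_digraph (cone F)"
proof -
  interpret pair_wf_digraph F by fact
  show ?thesis
    using in_arcsD1 in_arcsD2 by unfold_locales (auto simp: cone_def)
qed

text \<open>The apex goes to \<open>v\<close>. Its arcs are preserved because the copy of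
  \<open>F\<close> lies among the neighbours of \<open>v\<close>, and injectivity survives because
  \<open>v\<close> is not its own neighbour.\<close>

lemma contains_copy_coneI:
  assumes "pair_graph G" "pair_graph F" "v \<in> pverts G" "contains_copy (link G v) F"
  shows "contains_copy G (cone F)"
proof -
  interpret G: pair_graph G by fact
  interpret F: pair_graph F by fact
  obtain g where g: "inj_on g (pverts F)" "g ` pverts F \<subseteq> parcs G `` {v}"
    "\<And>u w. (u, w) \<in> parcs F \<Longrightarrow> (g u, g w) \<in> parcs G"
    using assms(4) by (rule contains_copyE) simp
  define h where "h = case_option v g"
  have nbr: "(v, g u) \<in> parcs G" if "u \<in> pverts F" for u using g(2) that by auto
  show ?thesis
  proof (rule contains_copyI[of _ _ h])
    have "v \<notin> g ` pverts F" using nbr G.no_loops' by blast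
    then show "inj_on h (pverts (cone F))"
      using g(1) by (auto simp: cone_def h_def inj_on_def)
    show "h ` pverts (cone F) \<subseteq> pverts G"
      using assms(3) G.in_arcsD2[OF nbr] by (auto simp: cone_def h_def)
    show "(h u, h w) \<in> parcs G" if "(u, w) \<in> parcs (cone F)" for u w
      using that nbr g(3) G.arcs_symmetric[OF nbr] by (auto simp: cone_def h_def)
  qed (rule G.pair_wf_digraph pair_wf_digraph_cone F.pair_wf_digraph)+
qed

text \<open>An empty \<open>F\<close> has to be treated apart: every graph contains it, so
  \<open>spex\<close> would be a \<open>Max\<close> over the empty set, but its cone is a single
  vertex.\<close>

lemma contains_copy_cone_empty:
  assumes "pair_graph G" "pair_graph F" "v \<in> pverts G" "pverts F = {}"
  shows "contains_copy G (cone F)"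
proof (rule contains_copy_coneI[OF assms(1-3)])
  interpret F: pair_graph F by fact
  interpret L: pair_graph "link G v" using assms(1) by (rule pair_graph_link)
  show "contains_copy (link G v) F"
    using assms(4) F.in_arcsD1
    by (intro contains_copyI[of _ _ undefined] L.pair_wf_digraph F.pair_wf_digraph) auto
qed

lemma contains_copy_mono:
  assumes "contains_copy H F" "pair_wf_digraph G" "pair_wf_digraph F"
    and "pverts H \<subseteq> pverts G" "parcs H \<subseteq> parcs G"
  shows "contains_copy G F"
  using assms by (elim contains_copyE) (rule contains_copyI, auto)

subsection \<open>Triangles and links\<close>

lemma pair_graph_triangle_subgraph:
  assumes "pair_graph G"
  shows "pair_graph (triangle_subgraph G)"
proof -
  interpret pair_graph G by fact
  have "parcs (triangle_subgraph G) \<subseteq> parcs G" by (auto simp: triangle_subgraph_def)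
  then have "finite (parcs (triangle_subgraph G))" using pair_finite_arcs by (rule finite_subset)
  then show ?thesis
    by unfold_locales
      (auto simp: triangle_subgraph_def symmetric_def sym_def pair_finite_verts
        intro: arcs_symmetric dest: in_arcsD1 in_arcsD2 no_loops')
qed

text \<open>The deleted edges lie in no triangle, so every triangle survives. This allows
  \<open>G\<close> to be replaced by \<open>H\<close> in the 3-clique spectral radius and in the
  triangle count.\<close>

lemma cliques_triangle_subgraph:
  assumes "pair_graph G"
  shows "cliques 3 (triangle_subgraph G) = cliques 3 G"
proof (intro set_eqI)
  fix T
  show "T \<in> cliques 3 (triangle_subgraph G) \<longleftrightarrow> T \<in> cliques 3 G"
  proof
    assume "T \<in> cliques 3 (triangle_subgraph G)"
    then show "T \<in> cliques 3 G"
      unfolding in_cliques_iff[OF assms] in_cliques_iff[OF pair_graph_triangle_subgraph[OF assms]]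
      by (auto simp: triangle_subgraph_def)
  next
    assume T: "T \<in> cliques 3 G"
    have "(u, v) \<in> parcs (triangle_subgraph G)" if "u \<in> T" "v \<in> T" "u \<noteq> v" for u v
    proof -
      have "(u, v) \<in> parcs G" using T that by (simp add: in_cliques_iff[OF assms])
      with T that show ?thesis by (auto simp: triangle_subgraph_def)
    qed
    with T show "T \<in> cliques 3 (triangle_subgraph G)"
      unfolding in_cliques_iff[OF assms] in_cliques_iff[OF pair_graph_triangle_subgraph[OF assms]]
      by (simp add: triangle_subgraph_def)
  qed
qed

lemma clique_spectral_radius_3_triangle_subgraph:
  assumes "pair_graph G"
  shows "clique_spectral_radius 3 (triangle_subgraph G) = clique_spectral_radius 3 G"
proof -
  have "clique_tensor 3 (triangle_subgraph G) = clique_tensor 3 G"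
    by (intro ext) (simp add: clique_tensor_def cliques_triangle_subgraph[OF assms])
  then show ?thesis
    by (simp add: clique_spectral_radius_def triangle_subgraph_def)
qed

lemma spectral_radius_3_le:
  assumes G: "pair_graph G" and ne: "pverts G \<noteq> {}" and "s \<ge> 0"
    and link_bound: "\<And>v y. v \<in> pverts G \<Longrightarrow>
      adjacency_form (link G v) y \<le> s * (\<Sum>j\<in>parcs G `` {v}. (y j)\<^sup>2)"
  shows "clique_spectral_radius 3 G \<le> s / 2 * clique_spectral_radius 2 G"
proof -
  interpret pair_graph G by fact
  obtain v where v: "v \<in> pverts G" using ne by auto
  \<comment> \<open>Unit vectors are eigenvectors for the eigenvalue 0, so the supremum is not over the empty set.\<close>
  have "tensor_eigenvalue 3 (pverts G) (clique_tensor 3 G) 0"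
    unfolding tensor_eigenvalue_def tensor_apply_clique_3[OF G]
  proof (intro exI conjI ballI)
    show "\<exists>i\<in>pverts G. (if i = v then 1 else 0 :: complex) \<noteq> 0" using v by auto
    \<comment> \<open>A nonzero summand would need \<open>j = k = v\<close>, which is a
      loop.\<close>
    show "(\<Sum>(j, k)\<in>parcs (link G i). (if j = v then 1 else 0) * (if k = v then 1 else 0)) / 2
        = 0 * (if i = v then 1 else 0 :: complex) ^ (3 - 1)" for i
      by (auto intro!: sum.neutral dest: no_loops')
  qed
  moreover have "cmod l \<le> s / 2 * clique_spectral_radius 2 G"
    if l: "tensor_eigenvalue 3 (pverts G) (clique_tensor 3 G) l" for l
  proof -
    obtain x where nz: "\<exists>i\<in>pverts G. x i \<noteq> 0"
      and eig: "\<And>i. i \<in> pverts G \<Longrightarrow> (\<Sum>(j, k)\<in>parcs (link G i). x j * x k) / 2 = l * (x i)\<^sup>2"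
      using l unfolding tensor_eigenvalue_def tensor_apply_clique_3[OF G] by auto
    \<comment> \<open>Squares are the right scale: the eigenvalue equation has
      \<open>(x i)\<^sup>2\<close> on one side, and the link bound at the moduli yields a sum of
      squares on the other.\<close>
    define y where "y i = (cmod (x i))\<^sup>2" for i
    have le: "cmod l * y i \<le> s / 2 * (\<Sum>j\<in>parcs G `` {i}. y j)" if i: "i \<in> pverts G" for i
    proof -
      have "cmod l * y i = cmod ((\<Sum>(j, k)\<in>parcs (link G i). x j * x k) / 2)"
        unfolding eig[OF i] y_def by (simp add: norm_mult norm_power)
      also have "\<dots> = cmod (\<Sum>(j, k)\<in>parcs (link G i). x j * x k) / 2"
        by (simp add: norm_divide)
      also have "\<dots> \<le> adjacency_form (link G i) (\<lambda>j. cmod (x j)) / 2"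
        unfolding adjacency_form_def by (intro divide_right_mono sum_norm_le) (auto simp: norm_mult)
      also have "\<dots> \<le> s / 2 * (\<Sum>j\<in>parcs G `` {i}. y j)"
        using link_bound[OF i, of "\<lambda>j. cmod (x j)"] unfolding y_def by simp
      finally show ?thesis .
    qed
    \<comment> \<open>Pairing the entrywise inequality with the nonnegative vector \<open>y\<close>
      turns its right side into the adjacency form of \<open>G\<close>.\<close>
    have "cmod l * (\<Sum>i\<in>pverts G. (y i)\<^sup>2) = (\<Sum>i\<in>pverts G. y i * (cmod l * y i))"
      by (simp add: sum_distrib_left power2_eq_square mult_ac)
    also have "\<dots> \<le> (\<Sum>i\<in>pverts G. y i * (s / 2 * (\<Sum>j\<in>parcs G `` {i}. y j)))"
      by (intro sum_mono mult_left_mono le) (auto simp: y_def)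
    also have "\<dots> = s / 2 * adjacency_form G y"
      unfolding adjacency_form_nbrs[OF G] by (simp add: sum_distrib_left mult_ac)
    also have "\<dots> \<le> s / 2 * (clique_spectral_radius 2 G * (\<Sum>i\<in>pverts G. (y i)\<^sup>2))"
      using \<open>s \<ge> 0\<close> by (intro mult_left_mono adjacency_form_le_spectral_radius G) auto
    finally have "cmod l * (\<Sum>i\<in>pverts G. (y i)\<^sup>2)
        \<le> s / 2 * clique_spectral_radius 2 G * (\<Sum>i\<in>pverts G. (y i)\<^sup>2)"
      by (simp only: mult.assoc)
    moreover obtain i where "i \<in> pverts G" "x i \<noteq> 0" using nz by auto
    then have "(\<Sum>i\<in>pverts G. (y i)\<^sup>2) > 0"
      by (intro sum_pos2[OF pair_finite_verts, of i]) (auto simp: y_def)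
    ultimately show ?thesis by simp
  qed
  ultimately show ?thesis
    unfolding clique_spectral_radius_def[of 3] tensor_spectral_radius_def
    by (intro cSup_least) auto
qed

text \<open>Count ordered triangles twice: each triangle has six orderings, and an ordering starting
  with \<open>v\<close> is \<open>v\<close> followed by an arc of its link.\<close>

lemma card_cliques_3_le:
  assumes "pair_graph G"
  shows "6 * card (cliques 3 G) \<le> (\<Sum>v\<in>pverts G. card (parcs (link G v)))"
proof -
  interpret pair_graph G by fact
  define P where "P T = {(a, b, c). {a, b, c} = T}" for T :: "'a set"
  have fin: "finite (parcs (link G v))" for v
    using pair_finite_arcs by (rule rev_finite_subset) auto
  have finP: "finite (P T)" and cardP: "6 \<le> card (P T)" if "T \<in> cliques 3 G" for T
  proof -
    have "card T = 3" "finite T" using that by (auto simp: in_cliques_iff[OF assms])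
    then show "finite (P T)"
      by (intro finite_subset[of "P T" "T \<times> T \<times> T"]) (auto simp: P_def)
    obtain a b c where abc: "T = {a, b, c}" "a \<noteq> b" "a \<noteq> c" "b \<noteq> c"
      using \<open>card T = 3\<close> by (auto simp: card_3_iff)
    have "card {(a, b, c), (a, c, b), (b, a, c), (b, c, a), (c, a, b), (c, b, a)} \<le> card (P T)"
      using \<open>finite (P T)\<close> by (rule card_mono) (auto simp: P_def abc(1))
    then show "6 \<le> card (P T)" using abc by simp
  qed
  have finC: "finite (cliques 3 G)"
    by (rule finite_subset[of _ "Pow (pverts G)"]) (auto simp: cliques_def pair_finite_verts)
  have "6 * card (cliques 3 G) \<le> (\<Sum>T\<in>cliques 3 G. card (P T))"
    using sum_mono[of "cliques 3 G" "\<lambda>_. 6" "\<lambda>T. card (P T)"] cardP by simp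
  also have "\<dots> = card (\<Union>T\<in>cliques 3 G. P T)"
    using finC finP by (subst card_UN_disjoint) (auto simp: P_def)
  also have "(\<Union>T\<in>cliques 3 G. P T) = Sigma (pverts G) (\<lambda>v. parcs (link G v))"
  proof -
    have "(\<Union>T\<in>cliques 3 G. P T) = {(a, b, c). {a, b, c} \<in> cliques 3 G}"
      by (auto simp: P_def)
    then show ?thesis
      using in_arcsD1 by (auto simp: triple_in_cliques_iff[OF assms])
  qed
  also have "card \<dots> = (\<Sum>v\<in>pverts G. card (parcs (link G v)))"
    using pair_finite_verts fin by simp
  finally show ?thesis .
qed

lemma card_cliques_3_le_spectral_radius:
  assumes G: "pair_graph G" and "s \<ge> 0"
    and link_bound: "\<And>v y. v \<in> pverts G \<Longrightarrow>
      adjacency_form (link G v) y \<le> s * (\<Sum>j\<in>parcs G `` {v}. (y j)\<^sup>2)"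
  shows "6 * real (card (cliques 3 G)) \<le> real (card (pverts G)) * clique_spectral_radius 2 G * s"
proof -
  have "6 * real (card (cliques 3 G)) \<le> (\<Sum>v\<in>pverts G. real (card (parcs (link G v))))"
    using card_cliques_3_le[OF G] by (simp flip: of_nat_sum)
  \<comment> \<open>At the all-one vector the form of a link counts its arcs and the link bound
    becomes \<open>s\<close> times the degree of \<open>v\<close>; the degrees add up to the form of
    \<open>G\<close> at the all-one vector.\<close>
  also have "\<dots> = (\<Sum>v\<in>pverts G. adjacency_form (link G v) (\<lambda>_. 1))"
    by (simp add: adjacency_form_def)
  also have "\<dots> \<le> (\<Sum>v\<in>pverts G. s * (\<Sum>j\<in>parcs G `` {v}. 1\<^sup>2))"
    by (intro sum_mono link_bound)
  also have "\<dots> = s * adjacency_form G (\<lambda>_. 1)"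
    unfolding adjacency_form_nbrs[OF G] by (simp add: sum_distrib_left)
  also have "\<dots> \<le> s * (clique_spectral_radius 2 G * (\<Sum>i\<in>pverts G. 1\<^sup>2))"
    using \<open>s \<ge> 0\<close> by (intro mult_left_mono adjacency_form_le_spectral_radius G)
  finally show ?thesis by (simp add: mult_ac)
qed

theorem theorem4p3:
  fixes G H :: "'a pair_pre_digraph" and F :: "'b pair_pre_digraph"
  assumes "pair_graph G"
    and "cliques 3 G \<noteq> {}"
    and "H = triangle_subgraph G"
    and "pair_graph F"
    and "\<forall>v\<in>pverts F. out_degree (with_proj F) v \<noteq> 0"
    and "gamma3 G > 1 / 2 * spex (max_degree H) F
       \<or> 6 * real (card (cliques 3 G))
           > real (card (pverts G)) * clique_spectral_radius 2 H * spex (max_degree H) F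
       \<or> clique_spectral_radius 3 G > 1 / 2 * real (max_degree H) * spex (max_degree H) F"
  shows "contains_copy G (cone F)"
proof (rule ccontr)
  assume no_cone: "\<not> contains_copy G (cone F)"
  interpret G: pair_graph G by fact
  interpret F: pair_graph F by fact
  have H: "pair_graph H" unfolding assms(3) using assms(1) by (rule pair_graph_triangle_subgraph)
  interpret H: pair_graph H by (rule H)
  have pverts_H: "pverts H = pverts G" by (simp add: assms(3) triangle_subgraph_def)
  have cliques_H: "cliques 3 H = cliques 3 G"
    unfolding assms(3) using assms(1) by (rule cliques_triangle_subgraph)
  have radius_H: "clique_spectral_radius 3 H = clique_spectral_radius 3 G"
    unfolding assms(3) using assms(1) by (rule clique_spectral_radius_3_triangle_subgraph)
  \<comment> \<open>An arc of \<open>H\<close> makes \<open>max_degree H\<close> positive, as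
    \<open>spex_nonneg\<close> requires.\<close>
  obtain a b where ab: "(a, b) \<in> parcs H"
  proof -
    obtain T where "T \<in> cliques 3 H" using assms(2) cliques_H by auto
    moreover from this obtain a b c where "T = {a, b, c}"
      by (auto simp: in_cliques_iff[OF H] card_3_iff)
    ultimately have "(a, b) \<in> parcs H" by (simp add: triple_in_cliques_iff[OF H])
    then show ?thesis by (rule that)
  qed
  then have a: "a \<in> pverts H" by (rule H.in_arcsD1)
  have "pverts F \<noteq> {}"
    using contains_copy_cone_empty[OF assms(1,4)] a pverts_H no_cone by blast
  moreover have no_isolated: "\<forall>v\<in>pverts F. parcs F `` {v} \<noteq> {}"
    using assms(5) unfolding out_degree_with_proj by fastforce
  ultimately have "parcs F \<noteq> {}" by auto
  have nbrs: "card (parcs H `` {v}) \<le> max_degree H" if "v \<in> pverts H" for v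
    using H.pair_finite_verts that by (rule out_degree_le_max_degree)
  have "finite (parcs H `` {a})"
    using H.pair_finite_verts by (rule rev_finite_subset) (auto dest: H.in_arcsD2)
  then have "card (parcs H `` {a}) > 0" using ab by (auto simp: card_gt_0_iff)
  then have "max_degree H > 0" using nbrs[OF a] by linarith
  define s where "s = spex (max_degree H) F"
  have s: "s \<ge> 0"
    unfolding s_def using \<open>max_degree H > 0\<close> \<open>parcs F \<noteq> {}\<close> by (rule spex_nonneg)
  have link_bound: "adjacency_form (link H v) y \<le> s * (\<Sum>j\<in>parcs H `` {v}. (y j)\<^sup>2)"
    if v: "v \<in> pverts H" for v y
  proof -
    have "\<not> contains_copy (link H v) F"
    proof
      assume "contains_copy (link H v) F"
      then have "contains_copy H (cone F)" by (rule contains_copy_coneI[OF H assms(4) v])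
      moreover have "parcs H \<subseteq> parcs G" by (auto simp: assms(3) triangle_subgraph_def)
      ultimately have "contains_copy G (cone F)"
        using G.pair_wf_digraph pair_wf_digraph_cone[OF F.pair_wf_digraph] pverts_H
        by (metis contains_copy_mono order_refl)
      with no_cone show False ..
    qed
    \<comment> \<open>The link of \<open>v\<close> has as many vertices as \<open>v\<close> has
      neighbours in \<open>H\<close>, hence at most \<open>max_degree H\<close>.\<close>
    then show ?thesis
      unfolding s_def
      using adjacency_form_le_spex[OF pair_graph_link[OF H] _ assms(4) no_isolated, of v] nbrs[OF v] by simp
  qed
  have "pverts H \<noteq> {}" using a by auto
  note r2_nonneg = spectral_radius_nonneg[OF H this]
    and r2_le = spectral_radius_le_max_degree[OF H this]
    and r3_le = spectral_radius_3_le[OF H this s link_bound, unfolded radius_H]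
  have "gamma3 G \<le> 1 / 2 * s"
  proof (cases "clique_spectral_radius 2 H = 0")
    \<comment> \<open>Division by zero makes \<open>gamma3 G\<close> zero here, so
      \<open>s \<ge> 0\<close> suffices.\<close>
    case True
    then show ?thesis using s by (simp add: gamma3_def flip: assms(3))
  next
    case False
    then show ?thesis
      using r3_le r2_nonneg by (simp add: gamma3_def field_simps flip: assms(3))
  qed
  moreover have "6 * real (card (cliques 3 G)) \<le> real (card (pverts G)) * clique_spectral_radius 2 H * s"
    using card_cliques_3_le_spectral_radius[OF H s link_bound] unfolding cliques_H pverts_H .
  moreover have "clique_spectral_radius 3 G \<le> 1 / 2 * real (max_degree H) * s"
    using r3_le mult_left_mono[OF r2_le, of "s / 2"] s by (simp add: mult_ac)
  ultimately show False using assms(6) unfolding s_def by linarith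
qed

end
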